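(* For any positive integers $p,q$, the unit pseudo-hyperbolic space $\mathbb{H}^{p,q}$ is a non-degenerate semi-Riemannian submanifold of $\mathbb{R}^{p,q}$.
   Context: $\mathrm{I}_{p,q}$ is the diagonal matrix with first $p$ diagonal entries $-1$ and remaining $q$ entries $1$; the Minkowski space $\mathbb{R}^{p,q}$ is $\mathbb{R}^{p+q}$ with scalar product $\langle u,v\rangle=u^{\top}\mathrm{I}_{p,q}v$ on each tangent space. The unit pseudo-hyperbolic space is $\mathbb{H}^{p,q}=\{(x_1,\dots,x_p,y_1,\dots,y_q)\in\mathbb{R}^{p,q}:-\sum_{j=1}^px_j^2+\sum_{j=1}^qy_j^2=-1\}$. A submanifold $X\subseteq\mathbb{R}^{p,q}$ is non-degenerate if for every $x\in X$ the restriction of $\langle\cdot,\cdot\rangle$ to $T_xX$ is non-degenerate, i.e. $\{u\in T_xX:\langle u,v\rangle=0\text{ for all }v\in T_xX\}=\{0\}$. *)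

theory Defs
  imports "HOL-Analysis.Analysis"
begin

section \<open>Smooth maps between Euclidean spaces\<close>

text \<open>Both notions are meant for open \<open>S\<close>. The recursion stays within one type by taking
  directional derivatives \<open>x \<mapsto> Df(x) v\<close>.\<close>

fun Ck_on :: "nat \<Rightarrow> 'a::euclidean_space set \<Rightarrow> ('a \<Rightarrow> 'b::euclidean_space) \<Rightarrow> bool" where
  "Ck_on 0 S f \<longleftrightarrow> continuous_on S f"
| "Ck_on (Suc k) S f \<longleftrightarrow>
     (\<forall>x\<in>S. f differentiable (at x)) \<and>
     (\<forall>v. Ck_on k S (\<lambda>x. frechet_derivative f (at x) v))"

definition smooth_on :: "'a::euclidean_space set \<Rightarrow> ('a \<Rightarrow> 'b::euclidean_space) \<Rightarrow> bool" where
  "smooth_on S f \<longleftrightarrow> (\<forall>k. Ck_on k S f)"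

section \<open>Submanifolds and tangent spaces\<close>

text \<open>Embedded submanifolds without boundary, given by slice charts.\<close>

definition smooth_submanifold_dim :: "nat \<Rightarrow> 'a::euclidean_space set \<Rightarrow> bool" where
  "smooth_submanifold_dim k X \<longleftrightarrow>
     (\<forall>x\<in>X. \<exists>U V L. \<exists>\<phi> \<psi> :: 'a \<Rightarrow> 'a.
        open U \<and> x \<in> U \<and> open V \<and> homeomorphism U V \<phi> \<psi> \<and>
        smooth_on U \<phi> \<and> smooth_on V \<psi> \<and>
        subspace L \<and> dim L = k \<and> \<phi> ` (U \<inter> X) = V \<inter> L)"

definition smooth_submanifold :: "'a::euclidean_space set \<Rightarrow> bool" where
  "smooth_submanifold X \<longleftrightarrow> (\<exists>k. smooth_submanifold_dim k X)"

definition tangent_space :: "'a::euclidean_space set \<Rightarrow> 'a \<Rightarrow> 'a set" where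
  "tangent_space X x =
     {v. \<exists>\<epsilon>>0. \<exists>\<gamma>::real \<Rightarrow> 'a. smooth_on {-\<epsilon><..<\<epsilon>} \<gamma> \<and> \<gamma> ` {-\<epsilon><..<\<epsilon>} \<subseteq> X \<and>
           \<gamma> 0 = x \<and> (\<gamma> has_vector_derivative v) (at 0)}"

text \<open>Smoothness of a map defined on a subset \<open>X\<close>, via local smooth extensions to the ambient
  space; only the values on \<open>X\<close> matter.\<close>

definition smooth_map_on :: "'a::euclidean_space set \<Rightarrow> ('a \<Rightarrow> 'b::euclidean_space) \<Rightarrow> bool" where
  "smooth_map_on X f \<longleftrightarrow>
     (\<forall>x\<in>X. \<exists>U F. open U \<and> x \<in> U \<and> smooth_on U F \<and> (\<forall>y\<in>U \<inter> X. F y = f y))"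

definition tangent_vector_field :: "'a::euclidean_space set \<Rightarrow> ('a \<Rightarrow> 'a) \<Rightarrow> bool" where
  "tangent_vector_field X V \<longleftrightarrow> smooth_map_on X V \<and> (\<forall>x\<in>X. V x \<in> tangent_space X x)"

section \<open>Semi-Riemannian submanifolds\<close>

definition nondegenerate_on :: "('a::euclidean_space \<Rightarrow> 'a \<Rightarrow> real) \<Rightarrow> 'a set \<Rightarrow> bool" where
  "nondegenerate_on b T \<longleftrightarrow> {u \<in> T. \<forall>v\<in>T. b u v = 0} = {0}"

definition form_index :: "('a::euclidean_space \<Rightarrow> 'a \<Rightarrow> real) \<Rightarrow> 'a set \<Rightarrow> nat" where
  "form_index b T =
     Max {dim W |W. subspace W \<and> W \<subseteq> T \<and> (\<forall>u\<in>W. u \<noteq> 0 \<longrightarrow> b u u < 0)}"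

text \<open>A semi-Riemannian metric on \<open>X\<close>: a smooth symmetric nondegenerate \<open>(0,2)\<close>-tensor field of
  constant index, where \<open>g x\<close> is the form on the tangent space at \<open>x\<close>. Values of \<open>g x\<close> off the
  tangent space are irrelevant.\<close>

definition semi_riemannian_metric ::
    "'a::euclidean_space set \<Rightarrow> ('a \<Rightarrow> 'a \<Rightarrow> 'a \<Rightarrow> real) \<Rightarrow> bool" where
  "semi_riemannian_metric X g \<longleftrightarrow>
     (\<forall>x\<in>X. \<forall>u\<in>tangent_space X x. \<forall>v\<in>tangent_space X x. g x u v = g x v u) \<and>
     (\<forall>x\<in>X. \<forall>u\<in>tangent_space X x. \<forall>v\<in>tangent_space X x. \<forall>w\<in>tangent_space X x. \<forall>a b.
        g x (a *\<^sub>R u + b *\<^sub>R v) w = a * g x u w + b * g x v w) \<and>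
     (\<forall>V W. tangent_vector_field X V \<longrightarrow> tangent_vector_field X W \<longrightarrow>
        smooth_map_on X (\<lambda>x. g x (V x) (W x))) \<and>
     (\<forall>x\<in>X. nondegenerate_on (g x) (tangent_space X x)) \<and>
     (\<exists>\<nu>. \<forall>x\<in>X. form_index (g x) (tangent_space X x) = \<nu>)"

text \<open>In the next two definitions \<open>b\<close> is the scalar product of the ambient vector space, which is
  used on every tangent space.\<close>

definition nondegenerate_submanifold ::
    "('a::euclidean_space \<Rightarrow> 'a \<Rightarrow> real) \<Rightarrow> 'a set \<Rightarrow> bool" where
  "nondegenerate_submanifold b X \<longleftrightarrow>
     smooth_submanifold X \<and> (\<forall>x\<in>X. nondegenerate_on b (tangent_space X x))"

definition semi_riemannian_submanifold ::
    "('a::euclidean_space \<Rightarrow> 'a \<Rightarrow> real) \<Rightarrow> 'a set \<Rightarrow> bool" where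
  "semi_riemannian_submanifold b X \<longleftrightarrow>
     smooth_submanifold X \<and> semi_riemannian_metric X (\<lambda>x. b)"

section \<open>Minkowski space and the unit pseudo-hyperbolic space\<close>

text \<open>The space \<open>\<real>\<^bsup>p,q\<^esup>\<close> is \<open>real ^ ('p + 'q)\<close> with \<open>p = CARD('p) \<ge> 1\<close> and \<open>q = CARD('q) \<ge> 1\<close>:
  the indices \<open>Inl j\<close> are the first \<open>p\<close> ones, the indices \<open>Inr j\<close> the remaining \<open>q\<close> ones.\<close>

definition Ipq :: "real ^ ('p::finite + 'q::finite) ^ ('p + 'q)" where
  "Ipq = (\<chi> i j. if i = j then (case i of Inl _ \<Rightarrow> -1 | Inr _ \<Rightarrow> 1) else 0)"

definition minkowski :: "real ^ ('p::finite + 'q::finite) \<Rightarrow> real ^ ('p + 'q) \<Rightarrow> real" where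
  "minkowski u v = u \<bullet> (Ipq *v v)"

definition pseudo_hyperbolic_space :: "(real ^ ('p::finite + 'q::finite)) set" where
  "pseudo_hyperbolic_space =
     {z. - (\<Sum>j\<in>UNIV. (z $ Inl j)\<^sup>2) + (\<Sum>j\<in>UNIV. (z $ Inr j)\<^sup>2) = -1}"

end

theory Submission
  imports Defs
begin

text \<open>Everything holds for the quadric \<open>\<langle>z,z\<rangle> = -1\<close> of an arbitrary nondegenerate symmetric bilinear
  form. Near a point \<open>x\<close> of the quadric, split \<open>z = t x + w\<close> with \<open>w\<close> orthogonal to \<open>x\<close>; then
  \<open>\<langle>z,z\<rangle> = -t\<^sup>2 + \<langle>w,w\<rangle>\<close>, and replacing the coordinate \<open>t\<close> by \<open>\<langle>z,z\<rangle> + 1\<close> is a slice chart on the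
  half-space \<open>t > 0\<close>. The tangent space at \<open>x\<close> is the orthogonal complement of \<open>x\<close>, on which the form
  is nondegenerate because \<open>\<langle>x,x\<rangle> \<noteq> 0\<close>. The index is constant because reflections in \<open>x - y\<close> or in
  \<open>x + y\<close> map \<open>x\<close> to \<open>\<plusminus>y\<close>, so that all tangent spaces are isometric.\<close>

section \<open>Calculus of smooth maps\<close>

lemma Ck_on_subset: "Ck_on k S f \<Longrightarrow> T \<subseteq> S \<Longrightarrow> Ck_on k T f"
  by (induction k arbitrary: f) (auto intro: continuous_on_subset)

text \<open>Since \<open>S\<close> is open, the derivative at a point of \<open>S\<close> sees only
  values on \<open>S\<close>, so equality passes to the derivatives of every order.\<close>

lemma Ck_on_cong:
  assumes "open S" "\<And>x. x \<in> S \<Longrightarrow> f x = g x"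
  shows "Ck_on k S f \<longleftrightarrow> Ck_on k S g"
proof -
  have *: "Ck_on k S f \<Longrightarrow> Ck_on k S g" if "\<And>x. x \<in> S \<Longrightarrow> f x = g x" for f g
    using that
  proof (induction k arbitrary: f g)
    case 0
    then show ?case by (simp cong: continuous_on_cong)
  next
    case (Suc k)
    have d: "(g has_derivative frechet_derivative f (at x)) (at x)" if "x \<in> S" for x
    proof -
      have "(f has_derivative frechet_derivative f (at x)) (at x)"
        using Suc.prems(1) that by (simp add: frechet_derivative_works)
      then show ?thesis
        by (rule has_derivative_transform_within_open[OF _ assms(1) that]) (rule Suc.prems(2))
    qed
    then have "g differentiable at x" if "x \<in> S" for x
      using that by (auto simp: differentiable_def)
    moreover have "Ck_on k S (\<lambda>x. frechet_derivative g (at x) v)" for v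
    proof (rule Suc.IH)
      show "Ck_on k S (\<lambda>x. frechet_derivative f (at x) v)"
        using Suc.prems(1) by simp
      show "frechet_derivative f (at x) v = frechet_derivative g (at x) v" if "x \<in> S" for x
        using frechet_derivative_at[OF d[OF that]] by simp
    qed
    ultimately show ?case by simp
  qed
  show ?thesis using *[of f g] *[of g f] assms(2) by auto
qed

text \<open>By uniqueness of derivatives, an explicit \<open>f'\<close> may replace
  \<open>frechet_derivative\<close>. The closure proofs below take derivatives apart with
  \<open>Ck_on_SucE\<close> and reassemble them with this rule.\<close>

lemma Ck_on_SucI:
  assumes "open S" "\<And>x. x \<in> S \<Longrightarrow> (f has_derivative f' x) (at x)"
    and "\<And>v. Ck_on k S (\<lambda>x. f' x v)"
  shows "Ck_on (Suc k) S f"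
proof -
  have "Ck_on k S (\<lambda>x. frechet_derivative f (at x) v)" for v
    using assms(3)[of v] frechet_derivative_at[OF assms(2)]
    by (subst Ck_on_cong[OF assms(1), where g = "\<lambda>x. f' x v"]) auto
  then show ?thesis
    using assms(2) by (auto simp: differentiable_def)
qed

text \<open>Product-type derivative formulas contain the original functions undifferentiated; this
  lowers their order so that induction hypotheses apply.\<close>

lemma Ck_on_SucD: "Ck_on (Suc k) S f \<Longrightarrow> Ck_on k S f"
proof (induction k arbitrary: f)
  case 0
  then show ?case
    by (auto intro!: continuous_at_imp_continuous_on differentiable_imp_continuous_within)
next
  case (Suc k)
  then show ?case
    by (auto simp del: Ck_on.simps(2) simp: Ck_on.simps(2)[of "Suc k"] Ck_on.simps(2)[of k])
qed

lemma Ck_on_SucE: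
  assumes "Ck_on (Suc k) S f"
  obtains f' where "\<And>x. x \<in> S \<Longrightarrow> (f has_derivative f' x) (at x)" "\<And>v. Ck_on k S (\<lambda>x. f' x v)"
  using assms by (force simp: frechet_derivative_works)

lemma Ck_on_const: "Ck_on k S (\<lambda>x. c)"
  by (induction k arbitrary: c) auto

lemma Ck_on_bounded_linear:
  assumes "bounded_linear f" "open S"
  shows "Ck_on k S f"
proof (cases k)
  case 0
  then show ?thesis using assms by (simp add: linear_continuous_on)
next
  case (Suc m)
  show ?thesis unfolding Suc
    by (rule Ck_on_SucI[OF assms(2), where f' = "\<lambda>_. f"])
       (auto intro: bounded_linear_imp_has_derivative assms Ck_on_const)
qed

lemma Ck_on_add:
  assumes "open S" "Ck_on k S f" "Ck_on k S g"
  shows "Ck_on k S (\<lambda>x. f x + g x)"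
  using assms(2,3)
proof (induction k arbitrary: f g)
  case 0
  then show ?case by (auto intro: continuous_on_add)
next
  case (Suc k)
  obtain f' where f': "\<And>x. x \<in> S \<Longrightarrow> (f has_derivative f' x) (at x)" "\<And>v. Ck_on k S (\<lambda>x. f' x v)"
    using Ck_on_SucE[OF Suc.prems(1)] by blast
  obtain g' where g': "\<And>x. x \<in> S \<Longrightarrow> (g has_derivative g' x) (at x)" "\<And>v. Ck_on k S (\<lambda>x. g' x v)"
    using Ck_on_SucE[OF Suc.prems(2)] by blast
  show ?case
    by (rule Ck_on_SucI[OF assms(1), where f' = "\<lambda>x v. f' x v + g' x v"])
       (auto intro: has_derivative_add f' g' Suc.IH)
qed

text \<open>Induction through the product rule. One proof serves scaling, multiplication and the
  form \<open>b\<close> itself.\<close>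

lemma Ck_on_bilinear:
  assumes "bounded_bilinear h" "open S" "Ck_on k S f" "Ck_on k S g"
  shows "Ck_on k S (\<lambda>x. h (f x) (g x))"
  using assms(3,4)
proof (induction k arbitrary: f g)
  case 0
  then show ?case using bounded_bilinear.continuous_on[OF assms(1)] by auto
next
  case (Suc k)
  obtain f' where f': "\<And>x. x \<in> S \<Longrightarrow> (f has_derivative f' x) (at x)" "\<And>v. Ck_on k S (\<lambda>x. f' x v)"
    using Ck_on_SucE[OF Suc.prems(1)] by blast
  obtain g' where g': "\<And>x. x \<in> S \<Longrightarrow> (g has_derivative g' x) (at x)" "\<And>v. Ck_on k S (\<lambda>x. g' x v)"
    using Ck_on_SucE[OF Suc.prems(2)] by blast
  show ?case
    by (rule Ck_on_SucI[OF assms(2), where f' = "\<lambda>x v. h (f x) (g' x v) + h (f' x v) (g x)"])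
       (auto intro!: bounded_bilinear.FDERIV[OF assms(1)] Ck_on_add[OF assms(2)] f' g' Suc.IH
         Suc.prems[THEN Ck_on_SucD])
qed

text \<open>The derivative of \<open>1/f\<close> involves \<open>1/f\<close> again, but only to
  order \<open>k\<close>, where the induction hypothesis supplies it.\<close>

lemma Ck_on_inverse:
  fixes f :: "'a::euclidean_space \<Rightarrow> real"
  assumes "open S" "\<And>x. x \<in> S \<Longrightarrow> f x \<noteq> 0" "Ck_on k S f"
  shows "Ck_on k S (\<lambda>x. inverse (f x))"
  using assms(3)
proof (induction k)
  case 0
  then show ?case using assms(2) by (auto intro: continuous_on_inverse)
next
  case (Suc k)
  obtain f' where f': "\<And>x. x \<in> S \<Longrightarrow> (f has_derivative f' x) (at x)" "\<And>v. Ck_on k S (\<lambda>x. f' x v)"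
    using Ck_on_SucE[OF Suc.prems] by blast
  note mult = Ck_on_bilinear[OF bounded_bilinear_mult assms(1)]
  have "Ck_on k S (\<lambda>x. - 1 * (inverse (f x) * f' x v * inverse (f x)))" for v
    using Suc.IH Ck_on_SucD[OF Suc.prems] f'(2) by (intro mult Ck_on_const)
  then show ?case
    by (intro Ck_on_SucI[OF assms(1), where f' = "\<lambda>x v. - (inverse (f x) * f' x v * inverse (f x))"])
       (auto intro!: Deriv.has_derivative_inverse assms(2) f'(1))
qed

text \<open>The derivative is \<open>f' / (2 sqrt f)\<close>: the induction hypothesis handles
  \<open>sqrt f\<close> to order \<open>k\<close>, and positivity allows
  \<open>Ck_on_inverse\<close> to be applied to it.\<close>

lemma Ck_on_sqrt:
  fixes f :: "'a::euclidean_space \<Rightarrow> real"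
  assumes "open S" "\<And>x. x \<in> S \<Longrightarrow> f x > 0" "Ck_on k S f"
  shows "Ck_on k S (\<lambda>x. sqrt (f x))"
  using assms(3)
proof (induction k)
  case 0
  then show ?case by (auto intro: continuous_on_real_sqrt)
next
  case (Suc k)
  obtain f' where f': "\<And>x. x \<in> S \<Longrightarrow> (f has_derivative f' x) (at x)" "\<And>v. Ck_on k S (\<lambda>x. f' x v)"
    using Ck_on_SucE[OF Suc.prems] by blast
  have "Ck_on k S (\<lambda>x. inverse (sqrt (f x)))"
    using Suc.IH Ck_on_SucD[OF Suc.prems] assms(2)
    by (intro Ck_on_inverse[OF assms(1)]) force+
  then have "Ck_on k S (\<lambda>x. f' x v * (inverse (sqrt (f x)) * (1/2)))" for v
    using f'(2) by (intro Ck_on_bilinear[OF bounded_bilinear_mult assms(1)] Ck_on_const)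
  moreover have "((\<lambda>x. sqrt (f x)) has_derivative (\<lambda>v. f' x v * (inverse (sqrt (f x)) * (1/2)))) (at x)"
    if "x \<in> S" for x
    using assms(2)[OF that] f'(1)[OF that]
    by (auto intro!: derivative_eq_intros simp: field_simps)
  ultimately show ?case
    by (intro Ck_on_SucI[OF assms(1)])
qed

section \<open>Closure properties at all orders simultaneously\<close>

lemma smooth_on_subset: "smooth_on S f \<Longrightarrow> T \<subseteq> S \<Longrightarrow> smooth_on T f"
  by (auto simp: smooth_on_def intro: Ck_on_subset)

lemma smooth_on_imp_continuous_on: "smooth_on S f \<Longrightarrow> continuous_on S f"
  by (metis Ck_on.simps(1) smooth_on_def)

lemma smooth_on_const: "smooth_on S (\<lambda>x. c)"
  by (simp add: smooth_on_def Ck_on_const)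

lemma smooth_on_bounded_linear: "open S \<Longrightarrow> bounded_linear f \<Longrightarrow> smooth_on S f"
  by (simp add: smooth_on_def Ck_on_bounded_linear)

lemma smooth_on_add:
  "open S \<Longrightarrow> smooth_on S f \<Longrightarrow> smooth_on S g \<Longrightarrow> smooth_on S (\<lambda>x. f x + g x)"
  by (simp add: smooth_on_def Ck_on_add)

lemma smooth_on_bilinear:
  "bounded_bilinear h \<Longrightarrow> open S \<Longrightarrow> smooth_on S f \<Longrightarrow> smooth_on S g \<Longrightarrow>
    smooth_on S (\<lambda>x. h (f x) (g x))"
  by (simp add: smooth_on_def Ck_on_bilinear)

lemma smooth_on_inverse:
  fixes f :: "'a::euclidean_space \<Rightarrow> real"
  shows "open S \<Longrightarrow> (\<And>x. x \<in> S \<Longrightarrow> f x \<noteq> 0) \<Longrightarrow> smooth_on S f \<Longrightarrow> smooth_on S (\<lambda>x. inverse (f x))"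
  by (simp add: smooth_on_def Ck_on_inverse)

lemma smooth_on_sqrt:
  fixes f :: "'a::euclidean_space \<Rightarrow> real"
  shows "open S \<Longrightarrow> (\<And>x. x \<in> S \<Longrightarrow> f x > 0) \<Longrightarrow> smooth_on S f \<Longrightarrow> smooth_on S (\<lambda>x. sqrt (f x))"
  by (simp add: smooth_on_def Ck_on_sqrt)

lemmas smooth_on_scaleR = smooth_on_bilinear[OF bounded_bilinear_scaleR]
lemmas smooth_on_mult = smooth_on_bilinear[OF bounded_bilinear_mult]

section \<open>The unit quadric of a scalar product\<close>

locale scalar_product = bounded_bilinear b
  for b :: "'a::euclidean_space \<Rightarrow> 'a \<Rightarrow> real" +
  assumes commute: "b u v = b v u"
    and nondegenerate: "(\<And>v. b u v = 0) \<Longrightarrow> u = 0"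
begin

definition quadric :: "'a set" where
  "quadric = {z. b z z = -1}"

lemmas expand = add_left add_right diff_left diff_right scaleR_left scaleR_right
  minus_left minus_right

section \<open>Slice charts of the quadric\<close>

lemma dim_orthogonal:
  assumes "b x x \<noteq> 0"
  shows "dim {w. b x w = 0} = DIM('a) - 1"
proof -
  \<comment> \<open>The Riesz representative of the functional \<open>b x\<close> for the Euclidean
    inner product; it turns the kernel of \<open>b x\<close> into a hyperplane.\<close>
  define a where "a = adjoint (b x) 1"
  have "linear (b x)"
    using bounded_linear_right[of x] by (rule bounded_linear.linear)
  then have a: "b x w = a \<bullet> w" for w
    using adjoint_works[of "b x" w 1] by (simp add: a_def inner_commute)
  moreover have "a \<noteq> 0" using assms a[of x] by auto
  ultimately show ?thesis by (simp add: dim_hyperplane)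
qed

lemma slice_chart:
  assumes x: "x \<in> quadric"
  shows "\<exists>U V L. \<exists>\<phi> \<psi> :: 'a \<Rightarrow> 'a.
        open U \<and> x \<in> U \<and> open V \<and> homeomorphism U V \<phi> \<psi> \<and>
        smooth_on U \<phi> \<and> smooth_on V \<psi> \<and>
        subspace L \<and> dim L = DIM('a) - 1 \<and> \<phi> ` (U \<inter> quadric) = V \<inter> L"
proof -
  have xx: "b x x = -1" using x by (simp add: quadric_def)
  \<comment> \<open>Write \<open>z = t x + w0\<close> with \<open>w0\<close> orthogonal to
    \<open>x\<close>, so \<open>t = - b x z\<close>. The map sends \<open>z\<close> to
    \<open>w0 + s x\<close> with \<open>s = b z z + 1\<close>, and the quadric is
    \<open>s = 0\<close>.\<close>
  define \<phi> where "\<phi> = (\<lambda>z. z + (b x z + (b z z + 1)) *\<^sub>R x)"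
  \<comment> \<open>Solving \<open>s = 1 - t^2 + b w0 w0\<close> for \<open>t^2\<close> at
    \<open>w = w0 + s x\<close>, where \<open>s = - b x w\<close>, gives
    \<open>t^2 = D w\<close>.\<close>
  define D where "D = (\<lambda>w. 1 + (b w w + (b x w * b x w + b x w)))"
  \<comment> \<open>Adding \<open>b x w\<close> times \<open>x\<close> removes the
    \<open>s x\<close> component; the root restores \<open>t\<close>, which is positive on
    \<open>U\<close>.\<close>
  define \<psi> where "\<psi> = (\<lambda>w. w + (b x w + sqrt (D w)) *\<^sub>R x)"
  define U where "U = {z. b x z < 0}"
  define V where "V = {w. D w > 0}"
  define L where "L = {w. b x w = 0}"
  have cont: "continuous_on UNIV (\<lambda>z. b x z)" "continuous_on UNIV D"
    unfolding D_def by (intro continuous_intros continuous_on)+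
  have openU: "open U"
    unfolding U_def by (intro open_Collect_less cont continuous_intros)
  have openV: "open V"
    unfolding V_def by (intro open_Collect_less cont continuous_intros)
  have lin: "smooth_on S (b x)" "smooth_on S (\<lambda>z. z)" if "open S" for S
    using that by (auto intro!: smooth_on_bounded_linear bounded_linear_right bounded_linear_ident)
  have sb: "smooth_on S (\<lambda>z. b z z)" if "open S" for S
    using that by (intro smooth_on_bilinear[OF bounded_bilinear_axioms] lin)
  have smU: "smooth_on U \<phi>"
    unfolding \<phi>_def using openU
    by (intro smooth_on_add smooth_on_scaleR smooth_on_const lin sb)
  have smD: "smooth_on V D"
    unfolding D_def using openV
    by (intro smooth_on_add smooth_on_mult smooth_on_const lin sb)
  have smV: "smooth_on V \<psi>"
    unfolding \<psi>_def using openV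
    by (intro smooth_on_add smooth_on_scaleR smooth_on_sqrt smooth_on_const lin smD)
       (auto simp: V_def)
  have b\<phi>: "b x (\<phi> z) = - (b z z + 1)" for z
    by (simp add: \<phi>_def expand xx)
  have D\<phi>: "D (\<phi> z) = (b x z)\<^sup>2" for z
    by (simp add: D_def b\<phi>) (simp add: \<phi>_def expand xx commute[of z x] algebra_simps power2_eq_square)
  have b\<psi>: "b x (\<psi> w) = - sqrt (D w)" for w
    by (simp add: \<psi>_def expand xx)
  have bb\<psi>: "b (\<psi> w) (\<psi> w) = - 1 - b x w" if "w \<in> V" for w
  proof -
    have "sqrt (D w) * sqrt (D w) = D w" using that by (simp add: V_def)
    then show ?thesis
      by (simp add: \<psi>_def expand xx commute[of w x] algebra_simps) (simp add: D_def)
  qed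
  have \<phi>V: "\<phi> z \<in> V" if "z \<in> U" for z using that by (simp add: V_def U_def D\<phi>)
  have \<psi>U: "\<psi> w \<in> U" if "w \<in> V" for w using that by (simp add: V_def U_def b\<psi>)
  have \<psi>\<phi>: "\<psi> (\<phi> z) = z" if "z \<in> U" for z
  proof -
    have "sqrt (D (\<phi> z)) = - b x z" using that by (simp add: D\<phi> U_def)
    then show ?thesis
      by (simp add: \<psi>_def b\<phi>) (simp add: \<phi>_def algebra_simps)
  qed
  have \<phi>\<psi>: "\<phi> (\<psi> w) = w" if "w \<in> V" for w
    by (simp add: \<phi>_def b\<psi> bb\<psi>[OF that]) (simp add: \<psi>_def algebra_simps)
  have "homeomorphism U V \<phi> \<psi>"
    by (intro homeomorphismI smooth_on_imp_continuous_on smU smV) (auto simp: \<phi>V \<psi>U \<psi>\<phi> \<phi>\<psi>)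
  moreover have "\<phi> ` (U \<inter> quadric) = V \<inter> L"
  proof
    show "\<phi> ` (U \<inter> quadric) \<subseteq> V \<inter> L"
      by (auto simp: \<phi>V L_def b\<phi> quadric_def)
    show "V \<inter> L \<subseteq> \<phi> ` (U \<inter> quadric)"
    proof
      fix w assume w: "w \<in> V \<inter> L"
      then have "\<psi> w \<in> U \<inter> quadric" by (auto simp: \<psi>U quadric_def bb\<psi> L_def)
      then show "w \<in> \<phi> ` (U \<inter> quadric)" using \<phi>\<psi>[of w] w by (metis IntD1 imageI)
    qed
  qed
  moreover have "subspace L" by (auto simp: L_def subspace_def expand zero_right)
  moreover have "dim L = DIM('a) - 1" unfolding L_def by (rule dim_orthogonal) (simp add: xx)
  moreover have "x \<in> U" by (simp add: U_def xx)
  ultimately show ?thesis using openU openV smU smV by blast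
qed

lemma smooth_submanifold_quadric: "smooth_submanifold quadric"
  unfolding smooth_submanifold_def smooth_submanifold_dim_def using slice_chart by blast

section \<open>Tangent spaces and nondegeneracy of the form on them\<close>

lemma tangent_space_quadric:
  assumes x: "x \<in> quadric"
  shows "tangent_space quadric x = {v. b x v = 0}"
proof (intro subset_antisym subsetI)
  fix v assume "v \<in> tangent_space quadric x"
  then obtain \<epsilon> and \<gamma> :: "real \<Rightarrow> 'a" where \<epsilon>: "\<epsilon> > 0"
    and \<gamma>: "\<gamma> ` {-\<epsilon><..<\<epsilon>} \<subseteq> quadric" "\<gamma> 0 = x" "(\<gamma> has_vector_derivative v) (at 0)"
    unfolding tangent_space_def by blast
  \<comment> \<open>The derivative of \<open>b (\<gamma> t) (\<gamma> t)\<close> at 0 is computed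
    twice: by the product rule, and as that of the constant -1.\<close>
  have "((\<lambda>t. b (\<gamma> t) (\<gamma> t)) has_vector_derivative (b x v + b v x)) (at 0)"
    using has_vector_derivative[OF \<gamma>(3) \<gamma>(3)] by (simp add: \<gamma>(2))
  moreover have "((\<lambda>t. b (\<gamma> t) (\<gamma> t)) has_vector_derivative 0) (at 0)"
  proof (rule has_vector_derivative_transform_within_open[where S = "{-\<epsilon><..<\<epsilon>}"])
    show "((\<lambda>t. -1::real) has_vector_derivative 0) (at 0)" by simp
    show "-1 = b (\<gamma> t) (\<gamma> t)" if "t \<in> {-\<epsilon><..<\<epsilon>}" for t
      using subsetD[OF \<gamma>(1) imageI[OF that]] by (simp add: quadric_def)
  qed (use \<epsilon> in auto)
  ultimately have "b x v + b v x = 0"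
    by (rule vector_derivative_unique_at)
  then show "v \<in> {v. b x v = 0}" using commute[of v x] by simp
next
  fix v assume "v \<in> {v. b x v = 0}"
  then have v: "b x v = 0" "b v x = 0" by (auto simp: commute[of v x])
  have xx: "b x x = -1" using x by (simp add: quadric_def)
  \<comment> \<open>For \<open>v\<close> orthogonal to \<open>x\<close>, the form takes the value
    \<open>- D t\<close> at \<open>x + t v\<close>; dividing by \<open>sqrt (D t)\<close> pushes the
    line onto the quadric.\<close>
  define D where "D = (\<lambda>t::real. 1 + (t * t) * (- b v v))"
  define \<gamma> where "\<gamma> = (\<lambda>t::real. inverse (sqrt (D t)) *\<^sub>R (x + t *\<^sub>R v))"
  \<comment> \<open>This choice gives both \<open>\<epsilon> \<le> 1\<close> and
    \<open>\<epsilon> * \<bar>b v v\<bar> < 1\<close>, so \<open>t^2 * \<bar>b v v\<bar> < 1\<close>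
    on the interval and \<open>D\<close> stays positive.\<close>
  define \<epsilon> where "\<epsilon> = inverse (1 + \<bar>b v v\<bar>)"
  have \<epsilon>: "\<epsilon> > 0" by (simp add: \<epsilon>_def add_pos_nonneg)
  have pos: "D t > 0" if "t \<in> {-\<epsilon><..<\<epsilon>}" for t
  proof -
    have t: "\<bar>t\<bar> < \<epsilon>" using that by auto
    have "\<epsilon> \<le> 1" by (simp add: \<epsilon>_def inverse_le_1_iff)
    then have "\<bar>t\<bar> * \<bar>t\<bar> \<le> \<epsilon> * 1" using t by (intro mult_mono) auto
    then have "(t * t) * \<bar>b v v\<bar> \<le> \<epsilon> * \<bar>b v v\<bar>"
      by (intro mult_right_mono) auto
    also have "\<dots> < 1" by (simp add: \<epsilon>_def field_simps)
    finally show ?thesis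
      using mult_left_mono[OF abs_ge_self[of "b v v"], of "t * t"] by (simp add: D_def)
  qed
  have ident: "smooth_on {-\<epsilon><..<\<epsilon>} (\<lambda>t. t)"
    by (intro smooth_on_bounded_linear bounded_linear_ident) auto
  have smD: "smooth_on {-\<epsilon><..<\<epsilon>} D"
    unfolding D_def by (intro smooth_on_add smooth_on_mult smooth_on_const ident) auto
  have "smooth_on {-\<epsilon><..<\<epsilon>} \<gamma>"
    unfolding \<gamma>_def
    by (intro smooth_on_add smooth_on_scaleR smooth_on_inverse smooth_on_sqrt smooth_on_const ident smD)
       (use pos in force)+
  moreover have "\<gamma> ` {-\<epsilon><..<\<epsilon>} \<subseteq> quadric"
  proof clarify
    fix t assume t: "t \<in> {-\<epsilon><..<\<epsilon>}"
    have "b (\<gamma> t) (\<gamma> t) = inverse (sqrt (D t)) * (inverse (sqrt (D t)) * (- D t))"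
      by (simp add: \<gamma>_def expand xx v) (simp add: D_def algebra_simps)
    also have "\<dots> = -1" using pos[OF t] by (simp add: field_simps)
    finally show "\<gamma> t \<in> quadric" by (simp add: quadric_def)
  qed
  moreover have "\<gamma> 0 = x" by (simp add: \<gamma>_def D_def)
  \<comment> \<open>Normalising does not change the velocity at 0, because \<open>D 0 = 1\<close>
    and \<open>D\<close> has zero derivative there.\<close>
  moreover have "(\<gamma> has_vector_derivative v) (at 0)"
    unfolding \<gamma>_def D_def has_vector_derivative_def
    by (rule derivative_eq_intros refl | simp)+
  ultimately show "v \<in> tangent_space quadric x"
    unfolding tangent_space_def using \<epsilon> by blast
qed

lemma nondegenerate_on_orthogonal:
  assumes "b x x = -1"
  shows "nondegenerate_on b {v. b x v = 0}"
proof -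
  have "u = 0" if u: "b x u = 0" "\<And>v. b x v = 0 \<Longrightarrow> b u v = 0" for u
  proof (rule nondegenerate)
    fix w
    \<comment> \<open>The argument is the projection of \<open>w\<close> along \<open>x\<close> to
      the orthogonal complement; as \<open>u\<close> is orthogonal to \<open>x\<close>, the
      correction term pairs to zero with it.\<close>
    have "b u (w + b x w *\<^sub>R x) = 0" by (rule u(2)) (simp add: expand assms)
    then show "b u w = 0" using u(1) by (simp add: expand commute[of u x])
  qed
  then show ?thesis by (auto simp: nondegenerate_on_def zero_left zero_right)
qed

section \<open>Reflections and constancy of the index\<close>

definition reflection :: "'a \<Rightarrow> 'a \<Rightarrow> 'a" where
  "reflection u z = z - (2 * b z u / b u u) *\<^sub>R u"

lemma linear_reflection: "linear (reflection u)"
  by (rule linearI) (auto simp: reflection_def expand algebra_simps add_divide_distrib)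

text \<open>No hypothesis on \<open>u\<close>: for isotropic \<open>u\<close> the division by zero makes the reflection the identity.\<close>

lemma reflection_isometry: "b (reflection u y) (reflection u z) = b y z"
  by (cases "b u u = 0") (auto simp: reflection_def expand commute[of u y] commute[of u z] field_simps)

text \<open>A vector in the kernel of an isometry is orthogonal to everything, hence zero by
  nondegeneracy.\<close>

lemma inj_isometry:
  assumes "linear R" "\<And>y z. b (R y) (R z) = b y z"
  shows "inj R"
  unfolding linear_injective_0[OF assms(1)]
proof (intro allI impI)
  fix u assume "R u = 0"
  then show "u = 0" using nondegenerate[of u] assms(2)[of u] by (simp add: zero_left)
qed

text \<open>The vector \<open>x - y\<close> is isotropic exactly when \<open>b x y = -1\<close>. In
  that case \<open>x + y\<close> has square -4, and its reflection sends \<open>x\<close> to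
  \<open>- y\<close>. The sign is harmless, as \<open>y\<close> and \<open>- y\<close> have the same
  orthogonal complement.\<close>

lemma reflection_transitive:
  assumes "b x x = -1" "b y y = -1"
  obtains u where "reflection u x = y \<or> reflection u x = - y"
proof (cases "b x y = -1")
  case False
  then have n: "b (x - y) (x - y) \<noteq> 0"
    using assms by (simp add: expand commute[of y x])
  have "2 * b x (x - y) / b (x - y) (x - y) = 1"
    using n assms by (simp add: expand commute[of y x])
  then have "reflection (x - y) x = y" by (simp add: reflection_def)
  then show ?thesis using that by blast
next
  case True
  then have "2 * b x (x + y) / b (x + y) (x + y) = 1"
    using assms by (simp add: expand commute[of y x])
  then have "reflection (x + y) x = - y" by (simp add: reflection_def)
  then show ?thesis using that by blast
qed

text \<open>The reflection carries negative definite subspaces of one complement to those of the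
  other, preserving dimension. Both maxima are thus taken over the same set, and the index is never
  computed.\<close>

lemma form_index_orthogonal_eq:
  assumes "b x x = -1" "b y y = -1"
  shows "form_index b {v. b x v = 0} = form_index b {v. b y v = 0}"
proof -
  let ?N = "\<lambda>x. {dim W |W. subspace W \<and> W \<subseteq> {v. b x v = 0} \<and> (\<forall>u\<in>W. u \<noteq> 0 \<longrightarrow> b u u < 0)}"
  \<comment> \<open>Proved for an arbitrary pair, so that exchanging \<open>x\<close> and
    \<open>y\<close> yields the reverse inclusion.\<close>
  have *: "?N x \<subseteq> ?N y" if xy: "b x x = -1" "b y y = -1" for x y
  proof clarify
    fix W assume W: "subspace W" "W \<subseteq> {v. b x v = 0}" "\<forall>u\<in>W. u \<noteq> 0 \<longrightarrow> b u u < 0"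
    obtain u where u: "reflection u x = y \<or> reflection u x = - y"
      using reflection_transitive[OF xy] .
    let ?R = "reflection u"
    have "b y (?R w) = 0" if "w \<in> W" for w
      using u reflection_isometry[of u x w] W(2) that by (auto simp: expand)
    moreover have "dim (?R ` W) = dim W"
      using inj_isometry[OF linear_reflection reflection_isometry, of u]
      by (intro dim_image_eq linear_reflection) (auto intro: inj_on_subset)
    moreover have "subspace (?R ` W)"
      using linear_reflection W(1) by (rule linear_subspace_image)
    moreover have "\<forall>w\<in>?R ` W. w \<noteq> 0 \<longrightarrow> b w w < 0"
      using W(3) by (auto simp: reflection_isometry linear_0[OF linear_reflection])
    ultimately show "\<exists>W'. dim W = dim W' \<and> subspace W' \<and> W' \<subseteq> {v. b y v = 0} \<and>
        (\<forall>u\<in>W'. u \<noteq> 0 \<longrightarrow> b u u < 0)"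
      by (intro exI[of _ "?R ` W"]) auto
  qed
  have "?N x = ?N y" using *[OF assms] *[OF assms(2,1)] by (rule subset_antisym)
  then show ?thesis unfolding form_index_def by simp
qed

section \<open>The induced metric on the quadric\<close>

lemma smooth_map_on_form:
  assumes "smooth_map_on X V" "smooth_map_on X W"
  shows "smooth_map_on X (\<lambda>x. b (V x) (W x))"
  unfolding smooth_map_on_def
proof
  fix x assume x: "x \<in> X"
  obtain S F where F: "open S" "x \<in> S" "smooth_on S F" "\<forall>y\<in>S \<inter> X. F y = V y"
    using assms(1) x unfolding smooth_map_on_def by blast
  obtain T G where G: "open T" "x \<in> T" "smooth_on T G" "\<forall>y\<in>T \<inter> X. G y = W y"
    using assms(2) x unfolding smooth_map_on_def by blast
  have "smooth_on (S \<inter> T) (\<lambda>x. b (F x) (G x))"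
    using F G by (intro smooth_on_bilinear[OF bounded_bilinear_axioms])
      (auto intro: smooth_on_subset)
  then show "\<exists>U H. open U \<and> x \<in> U \<and> smooth_on U H \<and> (\<forall>y\<in>U \<inter> X. H y = b (V y) (W y))"
    using F G by (intro exI[of _ "S \<inter> T"] exI[of _ "\<lambda>x. b (F x) (G x)"]) auto
qed

lemma nondegenerate_on_tangent_space:
  "x \<in> quadric \<Longrightarrow> nondegenerate_on b (tangent_space quadric x)"
  using nondegenerate_on_orthogonal[of x]
  by (simp add: tangent_space_quadric) (simp add: quadric_def)

lemma semi_riemannian_metric_quadric: "semi_riemannian_metric quadric (\<lambda>x. b)"
proof -
  have "\<exists>\<nu>. \<forall>x\<in>quadric. form_index b (tangent_space quadric x) = \<nu>"
  proof (cases "quadric = {}")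
    case False
    then obtain y where "y \<in> quadric" by blast
    then show ?thesis
      by (intro exI[of _ "form_index b {v. b y v = 0}"])
         (auto simp: tangent_space_quadric intro!: form_index_orthogonal_eq, auto simp: quadric_def)
  qed auto
  then show ?thesis
    unfolding semi_riemannian_metric_def
    using commute smooth_map_on_form nondegenerate_on_tangent_space
    by (auto simp: expand tangent_vector_field_def)
qed

lemma nondegenerate_submanifold_quadric: "nondegenerate_submanifold b quadric"
  by (simp add: nondegenerate_submanifold_def smooth_submanifold_quadric
      nondegenerate_on_tangent_space)

lemma semi_riemannian_submanifold_quadric: "semi_riemannian_submanifold b quadric"
  by (simp add: semi_riemannian_submanifold_def smooth_submanifold_quadric
      semi_riemannian_metric_quadric)

end

section \<open>Minkowski space\<close>

lemma Ipq_mult_vec_nth: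
  "(Ipq *v (v :: real ^ ('p::finite + 'q::finite))) $ i = (case i of Inl _ \<Rightarrow> -1 | Inr _ \<Rightarrow> 1) * v $ i"
  by (simp add: Ipq_def matrix_vector_mult_def if_distrib[of "\<lambda>x. x * _"] cong: if_cong)

lemma minkowski_eq_sum:
  "minkowski u (v :: real ^ ('p::finite + 'q::finite)) =
    (\<Sum>i\<in>UNIV. (case i of Inl _ \<Rightarrow> -1 | Inr _ \<Rightarrow> 1) * (u $ i * v $ i))"
  by (simp add: minkowski_def inner_vec_def Ipq_mult_vec_nth algebra_simps)

text \<open>Pairing with basis vectors recovers each coordinate up to sign, which yields
  nondegeneracy.\<close>

lemma minkowski_axis:
  "minkowski u (axis i 1 :: real ^ ('p::finite + 'q::finite)) = (case i of Inl _ \<Rightarrow> -1 | Inr _ \<Rightarrow> 1) * u $ i"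
  by (simp add: minkowski_eq_sum axis_def if_distrib[of "\<lambda>x. _ * x"] cong: if_cong)

interpretation minkowski: scalar_product
  "minkowski :: real ^ ('p::finite + 'q::finite) \<Rightarrow> real ^ ('p + 'q) \<Rightarrow> real"
proof -
  have "bounded_linear ((*v) (Ipq :: real ^ ('p + 'q) ^ ('p + 'q)))"
    by (rule matrix_vector_mul_bounded_linear)
  then have "bounded_bilinear (\<lambda>u v. u \<bullet> ((Ipq :: real ^ ('p + 'q) ^ ('p + 'q)) *v v))"
    by (rule bounded_bilinear.comp[OF bounded_bilinear_inner bounded_linear_ident])
  then have "bounded_bilinear (minkowski :: real ^ ('p + 'q) \<Rightarrow> real ^ ('p + 'q) \<Rightarrow> real)"
    by (simp add: minkowski_def[abs_def])
  then interpret bounded_bilinear "minkowski :: real ^ ('p + 'q) \<Rightarrow> real ^ ('p + 'q) \<Rightarrow> real" .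
  show "scalar_product (minkowski :: real ^ ('p + 'q) \<Rightarrow> real ^ ('p + 'q) \<Rightarrow> real)"
  proof
    fix u v :: "real ^ ('p + 'q)"
    show "minkowski u v = minkowski v u" by (simp add: minkowski_eq_sum mult.commute)
    show "u = 0" if "\<And>v. minkowski u v = 0"
    proof (rule vec_eq_iff[THEN iffD2], intro allI)
      fix i
      show "u $ i = 0 $ i" using that[of "axis i 1"]
        by (auto simp: minkowski_axis split: sum.splits)
    qed
  qed
qed

lemma pseudo_hyperbolic_space_eq_quadric:
  "(pseudo_hyperbolic_space :: (real ^ ('p::finite + 'q::finite)) set) = minkowski.quadric"
proof -
  have "minkowski z z = - (\<Sum>j\<in>UNIV. (z $ Inl j)\<^sup>2) + (\<Sum>j\<in>UNIV. (z $ Inr j)\<^sup>2)"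
    for z :: "real ^ ('p + 'q)"
    \<comment> \<open>Seeing the index type as a disjoint union splits the sum into its negative and
      positive blocks.\<close>
    unfolding minkowski_eq_sum UNIV_Plus_UNIV[symmetric]
    by (subst sum.Plus) (auto simp: sum_negf power2_eq_square)
  then show ?thesis by (simp add: pseudo_hyperbolic_space_def minkowski.quadric_def)
qed

theorem corollary4p21:
  shows "nondegenerate_submanifold minkowski
           (pseudo_hyperbolic_space :: (real ^ ('p::finite + 'q::finite)) set) \<and>
         semi_riemannian_submanifold minkowski
           (pseudo_hyperbolic_space :: (real ^ ('p + 'q)) set)"
  unfolding pseudo_hyperbolic_space_eq_quadric
  using minkowski.nondegenerate_submanifold_quadric minkowski.semi_riemannian_submanifold_quadric
  by blast

end
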